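(* Let $k$ be a positive integer. Then the generalized Petersen graph $\mathrm{GP}(2k+2,k)$ is strongly distance--balanced if and only if $k$ is odd.
   Context: For $n\ge 3$ and $k\in\{1,\dots,n-1\}\setminus\{n/2\}$, the generalized Petersen graph $\mathrm{GP}(n,k)$ has vertex set $\{u_i\mid i\in\mathbb{Z}_n\}\cup\{v_i\mid i\in\mathbb{Z}_n\}$ and edges $u_iu_{i+1}$, $v_iv_{i+k}$, $u_iv_i$ for $i\in\mathbb{Z}_n$. For an edge $uv$ of a graph $X$ and integers $k,l$, $D^k_l(u,v)=\{x\in V(X)\mid d(u,x)=k,\ d(v,x)=l\}$, with $d$ the path-length distance. $X$ is strongly distance--balanced if $|D^{k}_{k-1}(u,v)|=|D^{k-1}_{k}(u,v)|$ for every integer $k$ and every edge $uv$. *)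

theory Defs
  imports "Graph_Theory.Graph_Theory"
begin

text \<open>An undirected simple graph is, as usual in \<open>Graph_Theory\<close>, a loop-free symmetric digraph:
  every edge \<open>{x, y}\<close> is present as the two arcs \<open>(x, y)\<close> and \<open>(y, x)\<close>. With all weights equal
  to 1, \<open>\<mu>\<close> is the least length of a walk, and it is infinite if there is none.\<close>

definition graph_dist :: "('a, 'b) pre_digraph \<Rightarrow> 'a \<Rightarrow> 'a \<Rightarrow> ereal" where
  "graph_dist G = wf_digraph.\<mu> G (\<lambda>_. 1)"

definition dist_cell :: "('a, 'b) pre_digraph \<Rightarrow> int \<Rightarrow> int \<Rightarrow> 'a \<Rightarrow> 'a \<Rightarrow> 'a set" where
  "dist_cell G k l u v =
     {x \<in> verts G. graph_dist G u x = ereal (of_int k) \<and> graph_dist G v x = ereal (of_int l)}"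

definition strongly_distance_balanced :: "('a, 'b) pre_digraph \<Rightarrow> bool" where
  "strongly_distance_balanced G \<longleftrightarrow>
     (\<forall>k::int. \<forall>u v. u \<rightarrow>\<^bsub>G\<^esub> v \<longrightarrow>
        card (dist_cell G k (k - 1) u v) = card (dist_cell G (k - 1) k u v))"

datatype gp_vertex = U nat | V nat

text \<open>The residues modulo \<open>n\<close> are represented by the numbers below \<open>n\<close>. The parameters are
  meant to satisfy \<open>n \<ge> 3\<close>, \<open>1 \<le> k \<le> n - 1\<close> and \<open>2 * k \<noteq> n\<close>.\<close>

definition GP :: "nat \<Rightarrow> nat \<Rightarrow> gp_vertex pair_pre_digraph" where
  "GP n k =
     \<lparr> pverts = U ` {..<n} \<union> V ` {..<n},
       parcs = symcl ({(U i, U ((i + 1) mod n)) | i. i < n}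
                    \<union> {(V i, V ((i + k) mod n)) | i. i < n}
                    \<union> {(U i, V i) | i. i < n}) \<rparr>"

lemma mod_add_neq_self:
  fixes i d n :: nat
  assumes "i < n" "0 < d" "d < n"
  shows "(i + d) mod n \<noteq> i"
proof (cases "i + d < n")
  case True
  then show ?thesis using assms by simp
next
  case False
  then have "(i + d) mod n = i + d - n"
    using assms by (simp add: le_mod_geq)
  then show ?thesis using assms False by linarith
qed

lemma pair_graph_GP:
  assumes "3 \<le> n" "1 \<le> k" "k \<le> n - 1"
  shows "pair_graph (GP n k)"
proof
  have fin: "finite (pverts (GP n k))" by (simp add: GP_def)
  then show "finite (pverts (GP n k))" .
  have sub: "parcs (GP n k) \<subseteq> pverts (GP n k) \<times> pverts (GP n k)"
    using assms by (auto simp: GP_def symcl_def)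
  show "finite (parcs (GP n k))"
    using fin sub by (meson finite_SigmaI finite_subset)
  show "fst e \<in> pverts (GP n k)" "snd e \<in> pverts (GP n k)" if "e \<in> parcs (GP n k)" for e
    using sub that by auto
  show "symmetric (GP n k)"
    by (auto simp: symmetric_def sym_def GP_def symcl_def)
  show "fst e \<noteq> snd e" if "e \<in> parcs (GP n k)" for e
    using that assms mod_add_neq_self[of _ n k] mod_add_neq_self[of _ n 1]
    by (fastforce simp: GP_def symcl_def)
qed

end

theory Submission
  imports Defs
begin

text \<open>
  If \<open>k\<close> is odd, then \<open>k\<^sup>2 \<equiv> 1\<close> modulo \<open>n = 2k + 2\<close>, and every edge is reversed by an involutive
  automorphism: a reflection of the index for the edges of the two rims, and
  \<open>u\<^sub>j \<leftrightarrow> v\<^sub>l\<close> with \<open>l = i + k (j - i)\<close> for the spoke \<open>u\<^sub>i v\<^sub>i\<close>. Such an automorphism exchanges the two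
  cells to be compared.

  If \<open>k = 2h\<close> is even, the spoke \<open>u\<^sub>0 v\<^sub>0\<close> violates the condition at level \<open>h + 2\<close>: at most one
  vertex, namely \<open>u\<close> with index \<open>k + 1\<close>, has distance \<open>h + 2\<close> from \<open>u\<^sub>0\<close> and \<open>h + 1\<close> from \<open>v\<^sub>0\<close>,
  whereas the two inner vertices with indices \<open>j\<close> and \<open>-j\<close>, where \<open>j\<close> is the odd one of \<open>h\<close> and
  \<open>h + 1\<close>, have distance \<open>h + 1\<close> from \<open>u\<^sub>0\<close> and \<open>h + 2\<close> from \<open>v\<^sub>0\<close>. Distances are bounded from below
  by a function that changes by at most 1 along each edge.
\<close>

section \<open>Distances through powers of the arc relation\<close>

lemma (in wf_digraph) ex_awalk_length_iff_relpow:
  assumes "u \<in> verts G"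
  shows "(\<exists>p. awalk u p v \<and> length p = l) \<longleftrightarrow> (u, v) \<in> arcs_ends G ^^ l"
  using assms
proof (induction l arbitrary: u)
  case 0
  then show ?case by (auto simp: awalk_Nil_iff)
next
  case (Suc l)
  show ?case
  proof
    assume "\<exists>p. awalk u p v \<and> length p = Suc l"
    then obtain e p where e: "e \<in> arcs G" "tail G e = u" and "awalk (head G e) p v" "length p = l"
      by (auto simp: length_Suc_conv awalk_Cons_iff)
    then have "(head G e, v) \<in> arcs_ends G ^^ l"
      using Suc.IH[of "head G e"] by auto
    moreover have "(u, head G e) \<in> arcs_ends G"
      using e by (auto simp: arcs_ends_conv)
    ultimately show "(u, v) \<in> arcs_ends G ^^ Suc l"
      by (intro relpow_Suc_I2)
  next
    assume "(u, v) \<in> arcs_ends G ^^ Suc l"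
    then obtain w where "(u, w) \<in> arcs_ends G" and w: "(w, v) \<in> arcs_ends G ^^ l"
      by (blast dest: relpow_Suc_D2)
    then obtain e where e: "e \<in> arcs G" "tail G e = u" "head G e = w"
      by (auto simp: arcs_ends_conv)
    then obtain p where "awalk w p v" "length p = l"
      using Suc.IH[of w] w by auto
    with e show "\<exists>p. awalk u p v \<and> length p = Suc l"
      by (intro exI[of _ "e # p"]) (auto simp: awalk_Cons_iff)
  qed
qed

text \<open>Relation powers admit direct inductions on the length. The infimum over no length is
  infinite, which agrees with \<open>graph_dist\<close> for unreachable vertices.\<close>

lemma graph_dist_eq_INF_relpow:
  assumes "wf_digraph G" "u \<in> verts G"
  shows "graph_dist G u v = (INF l\<in>{l. (u, v) \<in> arcs_ends G ^^ l}. ereal (real l))"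
proof -
  interpret wf_digraph G by fact
  have cost: "awalk_cost (\<lambda>_. 1) p = real (length p)" for p :: "'b list"
    by (induction p) auto
  have "{l. (u, v) \<in> arcs_ends G ^^ l} = length ` {p. awalk u p v}"
    by (auto simp flip: ex_awalk_length_iff_relpow[OF assms(2)])
  then show ?thesis
    by (simp add: graph_dist_def \<mu>_def cost image_image)
qed

lemma graph_dist_le_iff_relpow:
  assumes "wf_digraph G" "u \<in> verts G"
  shows "graph_dist G u v \<le> ereal (real m) \<longleftrightarrow> (\<exists>l\<le>m. (u, v) \<in> arcs_ends G ^^ l)"
proof
  assume "graph_dist G u v \<le> ereal (real m)"
  \<comment> \<open>Being strictly below m + 1 already yields a walk of length less than m + 1, so
    no separate argument is needed that the infimum is attained.\<close>
  then have "graph_dist G u v < ereal (real (Suc m))"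
    by (rule le_less_trans) simp
  then obtain l where "(u, v) \<in> arcs_ends G ^^ l" "real l < real (Suc m)"
    by (auto simp: graph_dist_eq_INF_relpow[OF assms] INF_less_iff)
  then show "\<exists>l\<le>m. (u, v) \<in> arcs_ends G ^^ l"
    by (metis of_nat_less_iff less_Suc_eq_le)
next
  assume "\<exists>l\<le>m. (u, v) \<in> arcs_ends G ^^ l"
  then show "graph_dist G u v \<le> ereal (real m)"
    by (auto simp: graph_dist_eq_INF_relpow[OF assms] intro: INF_lower2)
qed

lemma relpow_Lipschitz:
  fixes f :: "'a \<Rightarrow> int"
  assumes "\<And>x y. (x, y) \<in> r \<Longrightarrow> f y \<le> f x + 1"
  shows "(x, y) \<in> r ^^ l \<Longrightarrow> f y \<le> f x + int l"
  by (induction l arbitrary: y) (auto dest!: assms, force)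

lemma graph_dist_ge_Lipschitz:
  fixes f :: "'a \<Rightarrow> int"
  assumes "wf_digraph G" "u \<in> verts G"
    and "\<And>x y. x \<rightarrow>\<^bsub>G\<^esub> y \<Longrightarrow> f y \<le> f x + 1"
  shows "ereal (of_int (f v - f u)) \<le> graph_dist G u v"
proof -
  have "of_int (f v - f u) \<le> real l" if "(u, v) \<in> arcs_ends G ^^ l" for l
    using relpow_Lipschitz[of "arcs_ends G" f, OF assms(3) that] by linarith
  then show ?thesis
    by (auto simp: graph_dist_eq_INF_relpow[OF assms(1,2)] intro: INF_greatest)
qed

lemma relpow_hom:
  assumes "\<And>x y. (x, y) \<in> r \<Longrightarrow> (\<phi> x, \<phi> y) \<in> r"
  shows "(x, y) \<in> r ^^ l \<Longrightarrow> (\<phi> x, \<phi> y) \<in> r ^^ l"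
  by (induction l arbitrary: y) (auto intro: assms)

lemma graph_dist_hom_le:
  assumes "wf_digraph G" "u \<in> verts G" "\<phi> u \<in> verts G"
    and "\<And>x y. x \<rightarrow>\<^bsub>G\<^esub> y \<Longrightarrow> \<phi> x \<rightarrow>\<^bsub>G\<^esub> \<phi> y"
  shows "graph_dist G (\<phi> u) (\<phi> v) \<le> graph_dist G u v"
  unfolding graph_dist_eq_INF_relpow[OF assms(1,2)] graph_dist_eq_INF_relpow[OF assms(1,3)]
  using relpow_hom[of "arcs_ends G" \<phi>, OF assms(4)] by (intro INF_superset_mono) auto

text \<open>A homomorphism never increases distances; as \<open>\<phi>\<close> is its own inverse on
  the vertices, it preserves them. It exchanges \<open>u\<close> and \<open>v\<close>, hence is a
  bijection between the two cells with itself as inverse.\<close>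

lemma card_dist_cell_flip:
  assumes wf: "wf_digraph G" and uv: "u \<in> verts G" "v \<in> verts G"
    and hom: "\<And>x y. x \<rightarrow>\<^bsub>G\<^esub> y \<Longrightarrow> \<phi> x \<rightarrow>\<^bsub>G\<^esub> \<phi> y"
    and verts: "\<And>x. x \<in> verts G \<Longrightarrow> \<phi> x \<in> verts G"
    and inv: "\<And>x. x \<in> verts G \<Longrightarrow> \<phi> (\<phi> x) = x"
    and "\<phi> u = v"
  shows "card (dist_cell G k l u v) = card (dist_cell G l k u v)"
proof -
  have dist: "graph_dist G (\<phi> x) (\<phi> y) = graph_dist G x y" if "x \<in> verts G" "y \<in> verts G" for x y
  proof (rule antisym)
    show "graph_dist G (\<phi> x) (\<phi> y) \<le> graph_dist G x y"
      using wf that hom verts by (intro graph_dist_hom_le) auto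
    have "graph_dist G (\<phi> (\<phi> x)) (\<phi> (\<phi> y)) \<le> graph_dist G (\<phi> x) (\<phi> y)"
      using wf that hom verts by (intro graph_dist_hom_le) auto
    then show "graph_dist G x y \<le> graph_dist G (\<phi> x) (\<phi> y)"
      by (simp add: inv that)
  qed
  have "\<phi> v = u" using inv uv \<open>\<phi> u = v\<close> by blast
  have "bij_betw \<phi> (dist_cell G k l u v) (dist_cell G l k u v)"
  proof (rule bij_betw_byWitness[where f' = \<phi>])
    show "\<phi> ` dist_cell G k l u v \<subseteq> dist_cell G l k u v"
      using dist[of u] dist[of v] uv \<open>\<phi> u = v\<close> \<open>\<phi> v = u\<close> verts
      by (auto simp: dist_cell_def)
    show "\<phi> ` dist_cell G l k u v \<subseteq> dist_cell G k l u v"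
      using dist[of u] dist[of v] uv \<open>\<phi> u = v\<close> \<open>\<phi> v = u\<close> verts
      by (auto simp: dist_cell_def)
  qed (auto simp: dist_cell_def inv)
  then show ?thesis by (rule bij_betw_same_card)
qed

section \<open>Vertices with integer indices modulo n\<close>

text \<open>Integer indices allow backward steps and reflections without truncated subtraction or
  explicit reductions.\<close>

definition outer :: "nat \<Rightarrow> int \<Rightarrow> gp_vertex" where
  "outer n i = U (nat (i mod int n))"

definition inner :: "nat \<Rightarrow> int \<Rightarrow> gp_vertex" where
  "inner n i = V (nat (i mod int n))"

lemma outer_of_nat: "j < n \<Longrightarrow> outer n (int j) = U j"
  and inner_of_nat: "j < n \<Longrightarrow> inner n (int j) = V j"
  by (simp_all add: outer_def inner_def)

lemma outer_cong: "i mod int n = j mod int n \<Longrightarrow> outer n i = outer n j"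
  and inner_cong: "i mod int n = j mod int n \<Longrightarrow> inner n i = inner n j"
  by (simp_all add: outer_def inner_def)

lemma outer_in_verts: "0 < n \<Longrightarrow> outer n i \<in> pverts (GP n k)"
  and inner_in_verts: "0 < n \<Longrightarrow> inner n i \<in> pverts (GP n k)"
  by (auto simp: outer_def inner_def GP_def nat_less_iff)

lemma GP_verts_cases:
  assumes "x \<in> pverts (GP n k)"
  obtains i where "x = outer n i" | i where "x = inner n i"
  using assms by (auto simp: GP_def simp flip: outer_of_nat inner_of_nat)

lemma nat_mod_add:
  assumes "0 < n"
  shows "(nat (i mod int n) + d) mod n = nat ((i + int d) mod int n)"
proof -
  have "int ((nat (i mod int n) + d) mod n) = (i + int d) mod int n"
    using assms by (simp add: zmod_int mod_add_left_eq)
  then show ?thesis by linarith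
qed

lemma
  assumes "0 < n"
  shows outer_arc: "(outer n i, outer n (i + 1)) \<in> parcs (GP n k)"
    and inner_arc: "(inner n i, inner n (i + int k)) \<in> parcs (GP n k)"
    and spoke_arc: "(outer n i, inner n i) \<in> parcs (GP n k)"
proof -
  let ?j = "nat (i mod int n)"
  have "?j < n" using assms by (simp add: nat_less_iff)
  then have "(U ?j, U ((?j + 1) mod n)) \<in> parcs (GP n k)"
    "(V ?j, V ((?j + k) mod n)) \<in> parcs (GP n k)" "(U ?j, V ?j) \<in> parcs (GP n k)"
    by (auto simp: GP_def symcl_def)
  then show "(outer n i, outer n (i + 1)) \<in> parcs (GP n k)"
    "(inner n i, inner n (i + int k)) \<in> parcs (GP n k)" "(outer n i, inner n i) \<in> parcs (GP n k)"
    using nat_mod_add[OF assms, of i 1] nat_mod_add[OF assms, of i k]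
    by (simp_all add: outer_def inner_def)
qed

lemma GP_arc_sym: "(x, y) \<in> parcs (GP n k) \<Longrightarrow> (y, x) \<in> parcs (GP n k)"
  by (auto simp: GP_def symcl_def)

text \<open>Reduces claims about arcs to one orientation of each of the three edge families, free of
  \<open>mod\<close>.\<close>

lemma GP_arc_induct [consumes 1, case_names sym outer inner spoke]:
  assumes "(x, y) \<in> parcs (GP n k)"
    and sym: "\<And>x y. P x y \<Longrightarrow> P y x"
    and outer: "\<And>i. P (outer n i) (outer n (i + 1))"
    and inner: "\<And>i. P (inner n i) (inner n (i + int k))"
    and spoke: "\<And>i. P (outer n i) (inner n i)"
  shows "P x y"
proof -
  have "P (U j) (U ((j + 1) mod n))" "P (V j) (V ((j + k) mod n))" "P (U j) (V j)" if "j < n" for j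
    using outer[of "int j"] inner[of "int j"] spoke[of "int j"] that nat_mod_add[of n "int j" 1]
      nat_mod_add[of n "int j" k]
    by (simp_all add: outer_def inner_def)
  then show ?thesis
    using assms(1) sym by (auto simp: GP_def symcl_def)
qed

lemma wf_digraph_GP:
  assumes "3 \<le> n" "1 \<le> k" "k \<le> n - 1"
  shows "wf_digraph (with_proj (GP n k))"
proof -
  interpret pair_graph "GP n k" using pair_graph_GP[OF assms] .
  show ?thesis by (rule wf_digraph_axioms)
qed

section \<open>Edge-reversing automorphisms\<close>

fun gp_reflect :: "nat \<Rightarrow> int \<Rightarrow> gp_vertex \<Rightarrow> gp_vertex" where
  "gp_reflect n s (U j) = outer n (s - int j)"
| "gp_reflect n s (V j) = inner n (s - int j)"

text \<open>Multiplication by k, centred so that s is fixed, turns rim steps into inner steps; if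
  k^2 is 1 modulo n, it also turns inner steps into rim steps.\<close>

fun gp_swap :: "nat \<Rightarrow> nat \<Rightarrow> int \<Rightarrow> gp_vertex \<Rightarrow> gp_vertex" where
  "gp_swap n k s (U j) = inner n (s + int k * (int j - s))"
| "gp_swap n k s (V j) = outer n (s + int k * (int j - s))"

lemma gp_reflect_simps:
  assumes "0 < n"
  shows "gp_reflect n s (outer n i) = outer n (s - i)"
    and "gp_reflect n s (inner n i) = inner n (s - i)"
  using assms by (simp_all add: outer_def inner_def mod_diff_right_eq)

lemma gp_swap_simps:
  assumes "0 < n"
  shows "gp_swap n k s (outer n i) = inner n (s + int k * (i - s))"
    and "gp_swap n k s (inner n i) = outer n (s + int k * (i - s))"
proof -
  have "(s + int k * (i mod int n - s)) mod int n = (s + int k * (i - s)) mod int n"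
    by (intro mod_add_cong mod_mult_cong mod_diff_cong refl) simp
  then show "gp_swap n k s (outer n i) = inner n (s + int k * (i - s))"
    "gp_swap n k s (inner n i) = outer n (s + int k * (i - s))"
    using assms by (simp_all add: outer_def inner_def)
qed

lemma gp_reflect_arc:
  assumes "0 < n" "(x, y) \<in> parcs (GP n k)"
  shows "(gp_reflect n s x, gp_reflect n s y) \<in> parcs (GP n k)"
  using assms(2)
proof (induction rule: GP_arc_induct)
  case (outer i)
  show ?case
    using outer_arc[OF assms(1), of "s - (i + 1)"]
    by (auto simp: gp_reflect_simps assms(1) intro: GP_arc_sym)
next
  case (inner i)
  show ?case
    using inner_arc[OF assms(1), of "s - (i + int k)" k]
    by (auto simp: gp_reflect_simps assms(1) intro: GP_arc_sym)
next
  case (sym x y)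
  then show ?case by (rule GP_arc_sym)
next
  case (spoke i)
  show ?case
    using spoke_arc[OF assms(1)] by (simp add: gp_reflect_simps assms(1))
qed

lemma gp_swap_arc:
  assumes "0 < n" and square: "int k * int k mod int n = 1 mod int n"
    and "(x, y) \<in> parcs (GP n k)"
  shows "(gp_swap n k s x, gp_swap n k s y) \<in> parcs (GP n k)"
  using assms(3)
proof (induction rule: GP_arc_induct)
  case (outer i)
  show ?case
    using inner_arc[OF assms(1), of "s + int k * (i - s)"]
    by (simp add: gp_swap_simps assms(1) algebra_simps)
next
  case (inner i)
  have "outer n (s + int k * (i + int k - s)) = outer n (s + int k * (i - s) + 1)"
    using mod_add_cong[OF refl square, of "s + int k * (i - s)"]
    by (intro outer_cong) (simp add: algebra_simps)
  then show ?case
    using outer_arc[OF assms(1), of "s + int k * (i - s)" k] by (simp only: gp_swap_simps assms(1))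
next
  case (sym x y)
  then show ?case by (rule GP_arc_sym)
next
  case (spoke i)
  show ?case
    using spoke_arc[OF assms(1)] GP_arc_sym[OF spoke_arc[OF assms(1)]] by (simp add: gp_swap_simps assms(1))
qed

text \<open>Two applications multiply the offset of the index from s by k^2.\<close>

lemma gp_swap_involution:
  assumes "0 < n" and square: "int k * int k mod int n = 1 mod int n"
    and "x \<in> pverts (GP n k)"
  shows "gp_swap n k s (gp_swap n k s x) = x"
proof -
  have "(s + int k * (s + int k * (i - s) - s)) mod int n = i mod int n" for i
    using mod_add_cong[OF refl mod_mult_cong[OF square refl], of s "i - s"]
    by (simp add: algebra_simps)
  with assms(3) show ?thesis
    by (elim GP_verts_cases) (auto simp: gp_swap_simps assms(1) intro: outer_cong inner_cong)
qed

lemma strongly_distance_balanced_GP: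
  assumes n: "3 \<le> n" "1 \<le> k" "k \<le> n - 1"
    and square: "int k * int k mod int n = 1 mod int n"
  shows "strongly_distance_balanced (with_proj (GP n k))"
  unfolding strongly_distance_balanced_def
proof (intro allI impI)
  fix l :: int and u v
  let ?G = "with_proj (GP n k)"
  have pos: "0 < n" using n by simp
  interpret wf_digraph ?G by (rule wf_digraph_GP[OF n])
  note wf = wf_digraph_axioms
  have reflect: "card (dist_cell ?G l m x y) = card (dist_cell ?G m l x y)"
    if "x \<in> verts ?G" "y \<in> verts ?G" "gp_reflect n s x = y" for l m s x y
  proof (rule card_dist_cell_flip[of _ _ _ "gp_reflect n s", OF wf that(1,2) _ _ _ that(3)])
    show "gp_reflect n s z \<in> verts ?G" "gp_reflect n s (gp_reflect n s z) = z"
      if "z \<in> verts ?G" for z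
      using that
      by (auto elim!: GP_verts_cases simp: gp_reflect_simps pos outer_in_verts inner_in_verts)
  qed (use gp_reflect_arc[OF pos] in auto)
  have swap: "card (dist_cell ?G l m x y) = card (dist_cell ?G m l x y)"
    if "x \<in> verts ?G" "y \<in> verts ?G" "gp_swap n k s x = y" for l m s x y
  proof (rule card_dist_cell_flip[of _ _ _ "gp_swap n k s", OF wf that(1,2) _ _ _ that(3)])
    show "gp_swap n k s z \<in> verts ?G" if "z \<in> verts ?G" for z
      using that
      by (auto elim!: GP_verts_cases simp: gp_swap_simps pos outer_in_verts inner_in_verts)
  qed (use gp_swap_arc[OF pos square] gp_swap_involution[OF pos square] in auto)
  have "dist_cell ?G l m x y = dist_cell ?G m l y x" for l m x y
    by (auto simp: dist_cell_def)
  note cell_sym = this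
  assume "u \<rightarrow>\<^bsub>?G\<^esub> v"
  then have "(u, v) \<in> parcs (GP n k)" by simp
  then have "\<forall>l m. card (dist_cell ?G l m u v) = card (dist_cell ?G m l u v)"
  proof (induction rule: GP_arc_induct)
    case (sym x y)
    then show ?case by (metis cell_sym)
  next
    case (outer i)
    \<comment> \<open>A reflection exchanges two indices exactly when its parameter is their sum
      modulo n, here i + (i + 1) and below i + (i + k).\<close>
    show ?case
      using pos by (intro allI reflect[of _ _ "2 * i + 1"])
        (auto simp: outer_in_verts gp_reflect_simps intro: outer_cong)
  next
    case (inner i)
    show ?case
      using pos by (intro allI reflect[of _ _ "2 * i + int k"])
        (auto simp: inner_in_verts gp_reflect_simps intro: inner_cong)
  next
    case (spoke i)
    show ?case
      using pos by (intro allI swap[of _ _ i])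
        (auto simp: outer_in_verts inner_in_verts gp_swap_simps)
  qed
  then show "card (dist_cell ?G l (l - 1) u v) = card (dist_cell ?G (l - 1) l u v)" by blast
qed

section \<open>A lower bound for distances when k is even\<close>

text \<open>The least \<open>\<bar>a\<bar> + \<bar>b\<bar>\<close> with \<open>a + k b \<equiv> j\<close> modulo \<open>2k + 2\<close>. Only \<open>b \<in> {-1, 0, 1}\<close> matters,
  since \<open>2k \<equiv> -2\<close> and \<open>-k \<equiv> k + 2\<close>.\<close>
definition gp_potential :: "nat \<Rightarrow> nat \<Rightarrow> int" where
  "gp_potential k j = min (min (int j) (2 * int k + 2 - int j))
     (1 + min \<bar>int j - int k\<bar> \<bar>int j - int k - 2\<bar>)"

text \<open>For even \<open>k\<close> the inner arcs preserve the parity of the index, so a walk from \<open>v\<^sub>0\<close> to an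
  inner vertex of odd index uses at least two spokes.\<close>
fun gp_height :: "nat \<Rightarrow> gp_vertex \<Rightarrow> int" where
  "gp_height k (U j) = gp_potential k j + 1"
| "gp_height k (V j) = gp_potential k j + (if even j then 0 else 2)"

text \<open>Replaces the nested minima by bounds for linear arithmetic. Taking x to be the potential
  itself gives its upper bounds.\<close>

lemma le_gp_potential_iff:
  "x \<le> gp_potential k j \<longleftrightarrow> x \<le> int j \<and> x \<le> 2 * int k + 2 - int j \<and>
     x \<le> 1 + \<bar>int j - int k\<bar> \<and> x \<le> 1 + \<bar>int j - int k - 2\<bar>"
  by (auto simp: gp_potential_def)

lemma gp_potential_outer:
  assumes "j < 2 * k + 2"
  shows "\<bar>gp_potential k ((j + 1) mod (2 * k + 2)) - gp_potential k j\<bar> \<le> 1"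
proof -
  define i where "i = (j + 1) mod (2 * k + 2)"
  have i: "int i = int j + 1 \<or> int i = 0 \<and> int j = 2 * int k + 1"
    using assms by (cases "j + 1 < 2 * k + 2") (auto simp: i_def not_less less_Suc_eq)
  have "int j < 2 * int k + 2" using assms by linarith
  note bounds = this order.refl[of "gp_potential k i", unfolded le_gp_potential_iff[of _ k i]]
    order.refl[of "gp_potential k j", unfolded le_gp_potential_iff[of _ k j]]
  have "gp_potential k i - 1 \<le> gp_potential k j"
    unfolding le_gp_potential_iff[of _ k j] using i bounds by (intro conjI) linarith+
  moreover have "gp_potential k j - 1 \<le> gp_potential k i"
    unfolding le_gp_potential_iff[of _ k i] using i bounds by (intro conjI) linarith+
  ultimately show ?thesis by (simp add: i_def abs_le_iff)
qed

text \<open>In a representation a + k b the step raises b by 1. If this gives b = 2, it is traded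
  for b = 0 with a lowered by 2, at no extra cost.\<close>

lemma gp_potential_inner:
  assumes "j < 2 * k + 2"
  shows "\<bar>gp_potential k ((j + k) mod (2 * k + 2)) - gp_potential k j\<bar> \<le> 1"
proof -
  define i where "i = (j + k) mod (2 * k + 2)"
  have i: "int i = int j + int k \<and> int j < int k + 2 \<or> int i = int j - int k - 2 \<and> int k + 2 \<le> int j"
    using assms by (cases "j + k < 2 * k + 2") (auto simp: i_def le_mod_geq)
  have "int j < 2 * int k + 2" using assms by linarith
  note bounds = this order.refl[of "gp_potential k i", unfolded le_gp_potential_iff[of _ k i]]
    order.refl[of "gp_potential k j", unfolded le_gp_potential_iff[of _ k j]]
  have "gp_potential k i - 1 \<le> gp_potential k j"
    unfolding le_gp_potential_iff[of _ k j] using i bounds by (intro conjI) linarith+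
  moreover have "gp_potential k j - 1 \<le> gp_potential k i"
    unfolding le_gp_potential_iff[of _ k i] using i bounds by (intro conjI) linarith+
  ultimately show ?thesis by (simp add: i_def abs_le_iff)
qed

text \<open>The summand added to the potential is 1 on the outer rim and 0 or 2 on inner vertices.
  It is constant along rim arcs and, by parity, along inner arcs; a spoke keeps the potential and
  changes the summand by 1.\<close>

lemma gp_height_Lipschitz:
  assumes "even k" "(x, y) \<in> parcs (GP (2 * k + 2) k)"
  shows "gp_height k y \<le> gp_height k x + 1"
proof -
  have parity: "even ((j + k) mod (2 * k + 2)) \<longleftrightarrow> even j" for j
    using assms(1) by (simp add: dvd_mod_iff)
  have "\<bar>gp_height k (U ((j + 1) mod (2 * k + 2))) - gp_height k (U j)\<bar> \<le> 1"
    "\<bar>gp_height k (V ((j + k) mod (2 * k + 2))) - gp_height k (V j)\<bar> \<le> 1"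
    "\<bar>gp_height k (V j) - gp_height k (U j)\<bar> \<le> 1" if "j < 2 * k + 2" for j
    using gp_potential_outer[OF that] gp_potential_inner[OF that] parity[of j] by simp_all
  moreover have "\<exists>j<2 * k + 2. (x, y) \<in> symcl {(U j, U ((j + 1) mod (2 * k + 2))),
      (V j, V ((j + k) mod (2 * k + 2))), (U j, V j)}"
    using assms(2) by (auto simp: GP_def symcl_def)
  ultimately show ?thesis
    by (fastforce simp: symcl_def simp del: gp_height.simps)
qed

section \<open>Upper bounds for distances by explicit walks\<close>

lemma outer_relpow:
  assumes "0 < n"
  shows "(outer n i, outer n (i + j)) \<in> parcs (GP n k) ^^ nat \<bar>j\<bar>"
proof -
  have up: "(outer n i, outer n (i + int l)) \<in> parcs (GP n k) ^^ l" for i l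
  proof (induction l)
    case (Suc l)
    have "(outer n (i + int l), outer n (i + int (Suc l))) \<in> parcs (GP n k)"
      using outer_arc[OF assms, of "i + int l" k] by (simp add: ac_simps)
    with Suc show ?case by auto
  qed simp
  have down: "(outer n i, outer n (i - int l)) \<in> parcs (GP n k) ^^ l" for i l
  proof (induction l)
    case (Suc l)
    have "(outer n (i - int l), outer n (i - int (Suc l))) \<in> parcs (GP n k)"
      using outer_arc[OF assms, of "i - int (Suc l)" k] by (auto intro: GP_arc_sym)
    with Suc show ?case by auto
  qed simp
  show ?thesis
    using up[of i "nat j"] down[of i "nat (- j)"] by (cases "0 \<le> j") auto
qed

text \<open>The walks follow the rim and then, as needed, take a spoke, one inner step and a spoke
  back. The sign e selects the direction of the inner step.\<close>

lemma GP_dist_outer_le: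
  assumes n: "3 \<le> n" "1 \<le> k" "k \<le> n - 1"
  shows "graph_dist (GP n k) (outer n 0) (outer n i) \<le> ereal (of_int \<bar>i\<bar>)"
    and "graph_dist (GP n k) (outer n 0) (inner n i) \<le> ereal (of_int (\<bar>i\<bar> + 1))"
    and "\<bar>e\<bar> = 1 \<Longrightarrow>
      graph_dist (GP n k) (outer n 0) (inner n i) \<le> ereal (of_int (\<bar>i + e * int k\<bar> + 2))"
    and "\<bar>e\<bar> = 1 \<Longrightarrow>
      graph_dist (GP n k) (outer n 0) (outer n i) \<le> ereal (of_int (\<bar>i + e * int k\<bar> + 3))"
proof -
  have pos: "0 < n" using n by simp
  let ?R = "parcs (GP n k)"
  have le: "graph_dist (GP n k) (outer n 0) y \<le> ereal (of_int l)"
    if "(outer n 0, y) \<in> ?R ^^ nat l" "0 \<le> l" for y l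
    using graph_dist_le_iff_relpow[OF wf_digraph_GP[OF n], of "outer n 0" y "nat l"] that
    by (auto simp: outer_in_verts pos)
  have 1: "(outer n 0, outer n i) \<in> ?R ^^ nat \<bar>i\<bar>" for i
    using outer_relpow[OF pos, of 0 i] by simp
  have 2: "(outer n 0, inner n i) \<in> ?R ^^ nat (\<bar>i\<bar> + 1)" for i
    using relcompI[OF 1 spoke_arc[OF pos]] by (simp add: nat_add_distrib)
  have step: "(inner n (i + e * int k), inner n i) \<in> ?R" if "\<bar>e\<bar> = 1" for e i
  proof (cases "e = 1")
    case True
    then show ?thesis using inner_arc[OF pos, of i k] by (auto intro: GP_arc_sym)
  next
    case False
    then have "e = - 1" using that by simp
    then show ?thesis using inner_arc[OF pos, of "i - int k" k] by simp
  qed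
  have 3: "(outer n 0, inner n i) \<in> ?R ^^ nat (\<bar>i + e * int k\<bar> + 2)" if "\<bar>e\<bar> = 1" for e i
  proof -
    have "nat (\<bar>i + e * int k\<bar> + 2) = Suc (nat (\<bar>i + e * int k\<bar> + 1))" by linarith
    then show ?thesis using relcompI[OF 2 step[OF that]] by simp
  qed
  have 4: "(outer n 0, outer n i) \<in> ?R ^^ nat (\<bar>i + e * int k\<bar> + 3)" if "\<bar>e\<bar> = 1" for e i
  proof -
    have "nat (\<bar>i + e * int k\<bar> + 3) = Suc (nat (\<bar>i + e * int k\<bar> + 2))" by linarith
    then show ?thesis using relcompI[OF 3[OF that] GP_arc_sym[OF spoke_arc[OF pos]]] by simp
  qed
  show "graph_dist (GP n k) (outer n 0) (outer n i) \<le> ereal (of_int \<bar>i\<bar>)"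
    by (rule le[OF 1]) simp
  show "graph_dist (GP n k) (outer n 0) (inner n i) \<le> ereal (of_int (\<bar>i\<bar> + 1))"
    by (rule le[OF 2]) simp
  show "graph_dist (GP n k) (outer n 0) (inner n i) \<le> ereal (of_int (\<bar>i + e * int k\<bar> + 2))"
    if "\<bar>e\<bar> = 1" by (rule le[OF 3[OF that]]) simp
  show "graph_dist (GP n k) (outer n 0) (outer n i) \<le> ereal (of_int (\<bar>i + e * int k\<bar> + 3))"
    if "\<bar>e\<bar> = 1" by (rule le[OF 4[OF that]]) simp
qed

section \<open>Unequal cells at a spoke for even k\<close>

lemma not_strongly_distance_balanced_GP:
  assumes "0 < k" "even k"
  shows "\<not> strongly_distance_balanced (with_proj (GP (2 * k + 2) k))"
proof
  define n where "n = 2 * k + 2"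
  let ?G = "with_proj (GP n k)"
  let ?d = "graph_dist ?G"
  have n: "3 \<le> n" "1 \<le> k" "k \<le> n - 1" and pos: "0 < n"
    using assms by (auto simp: n_def)
  interpret pair_graph "GP n k" using pair_graph_GP[OF n] .
  note wf = wf_digraph_GP[OF n]
  obtain h where h: "k = 2 * h" using assms(2) by blast
  then have "0 < h" using assms(1) by simp
  define m where "m = int h + 1"
  have ends: "outer n 0 = U 0" "inner n 0 = V 0" by (simp_all add: outer_def inner_def)
  have zero_verts: "U 0 \<in> verts ?G" "V 0 \<in> verts ?G"
    using outer_in_verts[OF pos, of 0 k] inner_in_verts[OF pos, of 0 k] by (simp_all add: ends)
  have height0: "gp_height k (U 0) = 1" "gp_height k (V 0) = 0"
    by (simp_all add: gp_potential_def)
  have lower: "ereal (of_int (gp_height k x - gp_height k y)) \<le> ?d y x" if "y \<in> verts ?G" for x y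
    using gp_height_Lipschitz[OF assms(2)]
    by (intro graph_dist_ge_Lipschitz[OF wf that]) (auto simp: n_def)
  have upper_outer: "?d (U 0) (outer n i) \<le> ereal (of_int \<bar>i\<bar>)"
    "?d (U 0) (outer n i) \<le> ereal (of_int (\<bar>i - int k\<bar> + 3))"
    "?d (U 0) (outer n i) \<le> ereal (of_int (\<bar>i + int k\<bar> + 3))" for i
    using GP_dist_outer_le(1)[OF n, of i] GP_dist_outer_le(4)[OF n, of 1 i]
      GP_dist_outer_le(4)[OF n, of "-1" i] by (simp_all add: ends)
  have upper_inner: "?d (U 0) (inner n i) \<le> ereal (of_int (\<bar>i\<bar> + 1))"
    "?d (U 0) (inner n i) \<le> ereal (of_int (\<bar>i - int k\<bar> + 2))"
    "?d (U 0) (inner n i) \<le> ereal (of_int (\<bar>i + int k\<bar> + 2))" for i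
    using GP_dist_outer_le(2)[OF n, of i] GP_dist_outer_le(3)[OF n, of 1 i]
      GP_dist_outer_le(3)[OF n, of "-1" i] by (simp_all add: ends)

  have far: "dist_cell ?G (m + 1) m (U 0) (V 0) \<subseteq> {U (k + 1)}"
  proof
    fix x assume x: "x \<in> dist_cell ?G (m + 1) m (U 0) (V 0)"
    then have "x \<in> pverts (GP n k)" and dU: "?d (U 0) x = ereal (of_int (m + 1))"
      and dV: "?d (V 0) x = ereal (of_int m)"
      by (auto simp: dist_cell_def)
    then obtain j where j: "j < n" "x = U j \<or> x = V j" by (auto simp: GP_def)
    \<comment> \<open>The signed representative in [-k, k + 1] makes the bounds in absolute values
      sharp enough.\<close>
    define i where "i = (if j \<le> k + 1 then int j else int j - int n)"
    have i: "- int k \<le> i" "i \<le> int k + 1" "i mod int n = int j mod int n"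
      using j(1) by (auto simp: i_def n_def)
    have ij: "i = int k + 1 \<Longrightarrow> j = k + 1" using j(1) by (auto simp: i_def split: if_splits)
    have le: "a \<le> b" if "ereal (of_int a) \<le> ereal (of_int b)" for a b :: int
      using that by simp
    show "x \<in> {U (k + 1)}"
    proof (cases "x = U j")
      case True
      then have "x = outer n i" using outer_cong[OF i(3)] j(1) by (simp add: outer_of_nat)
      note upper_outer[of i, folded this, unfolded dU, THEN le]
      \<comment> \<open>The bounds say h + 2 \<le> |i|, h - 1 \<le> |i - k| and h - 1 \<le> |i + k|;
        only i = k + 1 escapes a contradiction.\<close>
      then have "i = int k + 1" using i(1,2) h m_def by linarith
      then show ?thesis using True ij by simp
    next
      case False
      then have "x = V j" using j(2) by simp
      then have "x = inner n i" using inner_cong[OF i(3)] j(1) by (simp add: inner_of_nat)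
      note upper_inner[of i, folded this, unfolded dU, THEN le]
      \<comment> \<open>Distances from \<open>U 0\<close> leave one inner candidate,
        \<open>V 3\<close> for k = 2. Its height 4 puts it at distance at least 4 from
        \<open>V 0\<close>, whereas the cell demands 2.\<close>
      then have "i = int k + 1" "h = 1" using i(1,2) h m_def \<open>0 < h\<close> by linarith+
      then have "x = V 3" "k = 2" using \<open>x = V j\<close> ij h by simp_all
      then have "gp_height k x = 4" by (simp add: gp_potential_def)
      then show ?thesis
        using lower[OF zero_verts(2), of x] height0 dV \<open>h = 1\<close> by (simp add: m_def)
    qed
  qed

  \<comment> \<open>The heights 1 of \<open>U 0\<close> and 0 of \<open>V 0\<close> turn height m +
    1 into the lower bounds m and m + 1. Prepending the spoke gives the upper bound from
    \<open>V 0\<close>.\<close>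
  have near: "V j \<in> dist_cell ?G m (m + 1) (U 0) (V 0)"
    if V: "j < n" "gp_height k (V j) = m + 1" "?d (U 0) (V j) \<le> ereal (of_int m)" for j
  proof -
    have dU: "?d (U 0) (V j) = ereal (of_int m)"
      using lower[OF zero_verts(1), of "V j", unfolded V(2) height0] V(3) by (intro antisym) simp_all
    obtain l where "l \<le> h + 1" "(U 0, V j) \<in> arcs_ends ?G ^^ l"
      using V(3) graph_dist_le_iff_relpow[OF wf zero_verts(1), of "V j" "h + 1"]
      by (auto simp: m_def add.commute)
    moreover have "(V 0, U 0) \<in> arcs_ends ?G"
      using GP_arc_sym[OF spoke_arc[OF pos, of 0 k]] by (simp add: ends)
    ultimately have "\<exists>l\<le>h + 2. (V 0, V j) \<in> arcs_ends ?G ^^ l"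
      by (intro exI[of _ "Suc l"] conjI relpow_Suc_I2[of "V 0" "U 0"]) auto
    then have "?d (V 0) (V j) \<le> ereal (of_int (m + 1))"
      using graph_dist_le_iff_relpow[OF wf zero_verts(2), of "V j" "h + 2"]
      by (simp add: m_def add.commute)
    then have "?d (V 0) (V j) = ereal (of_int (m + 1))"
      using lower[OF zero_verts(2), of "V j", unfolded V(2) height0] by (intro antisym) simp_all
    with dU show ?thesis
      using \<open>j < n\<close> by (auto simp: dist_cell_def GP_def)
  qed

  \<comment> \<open>Both h and h + 1 have potential h, and the odd one gets the summand 2, so its
    inner vertex has height h + 2 = m + 1. The same holds for the mirror image n - j.\<close>
  define j where "j = (if odd h then h else h + 1)"
  have j: "odd j" "j = h \<or> j = h + 1" by (auto simp: j_def)
  have "V j \<in> dist_cell ?G m (m + 1) (U 0) (V 0)"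
  proof (rule near)
    show "j < n" using j(2) by (auto simp: n_def h)
    show "gp_height k (V j) = m + 1"
      using j \<open>0 < h\<close> by (auto simp: gp_potential_def m_def h)
    show "?d (U 0) (V j) \<le> ereal (of_int m)"
      using upper_inner(1,2)[of "int j"] j(2) inner_of_nat[OF \<open>j < n\<close>] \<open>0 < h\<close>
      by (auto simp: m_def h add.commute)
  qed
  moreover have "V (n - j) \<in> dist_cell ?G m (m + 1) (U 0) (V 0)"
  proof (rule near)
    show "n - j < n" using j pos by (auto simp: n_def h intro: odd_pos)
    have "odd (n - j)" using j by (auto simp: n_def h)
    moreover have "int (n - j) = int n - int j" using j(2) by (auto simp: n_def h)
    ultimately show "gp_height k (V (n - j)) = m + 1"
      using j \<open>0 < h\<close> by (auto simp: gp_potential_def m_def n_def h)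
    have "inner n (- int j) = V (n - j)"
      using inner_cong[of "- int j" n "int (n - j)"] inner_of_nat[OF \<open>n - j < n\<close>]
        \<open>int (n - j) = int n - int j\<close>
      by simp
    then show "?d (U 0) (V (n - j)) \<le> ereal (of_int m)"
      using upper_inner(1,3)[of "- int j"] j(2) \<open>0 < h\<close>
      by (auto simp: m_def h add.commute)
  qed
  moreover have "V j \<noteq> V (n - j)"
    using j(2) \<open>0 < h\<close> by (auto simp: n_def h)
  moreover have "finite (dist_cell ?G m (m + 1) (U 0) (V 0))"
    by (simp add: dist_cell_def pair_finite_verts)
  ultimately have "2 \<le> card (dist_cell ?G m (m + 1) (U 0) (V 0))"
    using card_mono[of _ "{V j, V (n - j)}"] by (metis card_2_iff empty_subsetI insert_subset)
  moreover have "card (dist_cell ?G (m + 1) m (U 0) (V 0)) \<le> 1"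
    using card_mono[OF _ far] by simp
  moreover assume "strongly_distance_balanced (with_proj (GP (2 * k + 2) k))"
  then have "card (dist_cell ?G (m + 1) m (U 0) (V 0)) = card (dist_cell ?G m (m + 1) (U 0) (V 0))"
    using spoke_arc[OF pos, of 0 k]
    unfolding strongly_distance_balanced_def n_def[symmetric] ends
    by (auto dest: spec[of _ "m + 1"])
  ultimately show False by simp
qed

theorem theorem4p8:
  fixes k :: nat
  assumes "k > 0"
  shows "strongly_distance_balanced (with_proj (GP (2 * k + 2) k)) \<longleftrightarrow> odd k"
proof
  assume "odd k"
  then obtain h where "k = 2 * h + 1" by (elim oddE)
  \<comment> \<open>This is k^2 - 1 = (k - 1)(k + 1) with k - 1 = 2h.\<close>
  then have "int k * int k = 1 + int h * int (2 * k + 2)"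
    by (simp add: algebra_simps)
  then have "int k * int k mod int (2 * k + 2) = 1 mod int (2 * k + 2)"
    by (metis mod_mult_self1)
  then show "strongly_distance_balanced (with_proj (GP (2 * k + 2) k))"
    using assms by (intro strongly_distance_balanced_GP) auto
qed (use assms not_strongly_distance_balanced_GP in blast)

end
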